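(* Let $(X,d)$ be a complete semimetric space with a triangle function $\Phi$ that is continuous at $(0,0)$ and satisfies the following conditions: 1) $\Phi(ku,kv)=k\Phi(u,v)$ for all $k,u,v\in[0,\infty)$; 2) for every $0\leqslant a<1$ there exists $C(a)>0$ such that for every positive integer $p$ one has $\Phi(1,\Phi(a,\Phi(a^2,\ldots,\Phi(a^{p-1},a^{p}))))\leqslant C(a)$. Let $T\colon X\to X$ be a contraction mapping, i.e., there exists $\alpha\in[0,1)$ such that $d(Tx,Ty)\leqslant\alpha\, d(x,y)$ for all $x,y\in X$. Then $T$ has a unique fixed point.
   Context: Let $X$ be a nonempty set. A semimetric on $X$ is a map $d\colon X\times X\to[0,\infty)$ such that $d(x,y)=0$ if and only if $x=y$, and $d(x,y)=d(y,x)$ for all $x,y\in X$ (no triangle inequality is required). The pair $(X,d)$ is then called a semimetric space. A function $\Phi\colon[0,\infty)\times[0,\infty)\to[0,\infty)$ is a triangle function for $d$ if $\Phi$ is symmetric, nondecreasing in each of its arguments, $\Phi(0,0)=0$, and $d(x,y)\leqslant\Phi(d(x,z),d(z,y))$ for all $x,y,z\in X$. Convergence, Cauchy sequences and completeness are defined as usual: $x_n\to x$ means $d(x_n,x)\to0$; $(x_n)$ is Cauchy if for every $\varepsilon>0$ there is $N$ with $d(x_n,x_m)<\varepsilon$ for all $n,m\geqslant N$; $(X,d)$ is complete if every Cauchy sequence converges to a point of $X$. For $p=1$ the nested expression in condition 2) is $\Phi(1,a)$, for $p=2$ it is $\Phi(1,\Phi(a,a^2))$, and so on (with $a^0=1$).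 *)

theory Defs
  imports "HOL-Analysis.Analysis"
begin

text \<open>
  A space is given by a carrier set \<open>X\<close> and a function \<open>d\<close>; nothing is assumed about \<open>d\<close> outside
  \<open>X\<close>. Likewise a function on \<open>[0, \<infinity>) \<times> [0, \<infinity>)\<close> is a curried function on the reals, about which
  nothing is assumed at negative arguments.
\<close>

locale semimetric_space =
  fixes X :: "'a set" and d :: "'a \<Rightarrow> 'a \<Rightarrow> real"
  assumes nonempty: "X \<noteq> {}"
    and nonneg: "\<lbrakk>x \<in> X; y \<in> X\<rbrakk> \<Longrightarrow> 0 \<le> d x y"
    and zero_iff: "\<lbrakk>x \<in> X; y \<in> X\<rbrakk> \<Longrightarrow> d x y = 0 \<longleftrightarrow> x = y"
    and sym: "\<lbrakk>x \<in> X; y \<in> X\<rbrakk> \<Longrightarrow> d x y = d y x"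

definition semimetric_converges ::
    "'a set \<Rightarrow> ('a \<Rightarrow> 'a \<Rightarrow> real) \<Rightarrow> (nat \<Rightarrow> 'a) \<Rightarrow> 'a \<Rightarrow> bool"
  where "semimetric_converges X d s x \<longleftrightarrow>
    range s \<subseteq> X \<and> x \<in> X \<and> (\<lambda>n. d (s n) x) \<longlonglongrightarrow> 0"

definition semimetric_Cauchy ::
    "'a set \<Rightarrow> ('a \<Rightarrow> 'a \<Rightarrow> real) \<Rightarrow> (nat \<Rightarrow> 'a) \<Rightarrow> bool"
  where "semimetric_Cauchy X d s \<longleftrightarrow>
    range s \<subseteq> X \<and> (\<forall>\<epsilon>>0. \<exists>N. \<forall>n\<ge>N. \<forall>m\<ge>N. d (s n) (s m) < \<epsilon>)"

definition semimetric_complete :: "'a set \<Rightarrow> ('a \<Rightarrow> 'a \<Rightarrow> real) \<Rightarrow> bool"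
  where "semimetric_complete X d \<longleftrightarrow>
    (\<forall>s. semimetric_Cauchy X d s \<longrightarrow> (\<exists>x. semimetric_converges X d s x))"

definition triangle_function ::
    "'a set \<Rightarrow> ('a \<Rightarrow> 'a \<Rightarrow> real) \<Rightarrow> (real \<Rightarrow> real \<Rightarrow> real) \<Rightarrow> bool"
  where "triangle_function X d \<Phi> \<longleftrightarrow>
    (\<forall>u\<ge>0. \<forall>v\<ge>0. 0 \<le> \<Phi> u v) \<and>
    (\<forall>u\<ge>0. \<forall>v\<ge>0. \<Phi> u v = \<Phi> v u) \<and>
    (\<forall>v\<ge>0. mono_on {0..} (\<lambda>u. \<Phi> u v)) \<and>
    (\<forall>u\<ge>0. mono_on {0..} (\<lambda>v. \<Phi> u v)) \<and>
    \<Phi> 0 0 = 0 \<and>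
    (\<forall>x\<in>X. \<forall>y\<in>X. \<forall>z\<in>X. d x y \<le> \<Phi> (d x z) (d z y))"

text \<open>
  The iterated expression \<open>\<Phi>(1, \<Phi>(a, \<Phi>(a\<^sup>2, \<dots>, \<Phi>(a\<^bsup>p-1\<^esup>, a\<^bsup>p\<^esup>))))\<close>, meant for \<open>p \<ge> 1\<close>.
\<close>

definition iterated :: "(real \<Rightarrow> real \<Rightarrow> real) \<Rightarrow> real \<Rightarrow> nat \<Rightarrow> real"
  where "iterated \<Phi> a p = foldr \<Phi> (map (\<lambda>i. a ^ i) [0..<p]) (a ^ p)"

lemma "iterated \<Phi> a 1 = \<Phi> 1 a"
  and "iterated \<Phi> a 2 = \<Phi> 1 (\<Phi> a (a ^ 2))"
  and "iterated \<Phi> a 3 = \<Phi> 1 (\<Phi> a (\<Phi> (a ^ 2) (a ^ 3)))"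
  by (simp_all add: iterated_def upt_rec numeral_eq_Suc)

definition contraction_mapping :: "'a set \<Rightarrow> ('a \<Rightarrow> 'a \<Rightarrow> real) \<Rightarrow> ('a \<Rightarrow> 'a) \<Rightarrow> bool"
  where "contraction_mapping X d T \<longleftrightarrow>
    T \<in> X \<rightarrow> X \<and> (\<exists>\<alpha>. 0 \<le> \<alpha> \<and> \<alpha> < 1 \<and> (\<forall>x\<in>X. \<forall>y\<in>X. d (T x) (T y) \<le> \<alpha> * d x y))"

end

theory Submission
  imports Defs
begin

text \<open>
  Homogeneity turns the iterated expression into the recursion
  \<open>I\<^bsub>p+1\<^esub> = \<Phi>(1, a I\<^sub>p)\<close>, so the triangle inequality through \<open>T x\<close> bounds \<open>d(x, T\<^bsup>p+1\<^esup> x)\<close> by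
  \<open>d(x, T x) I\<^sub>p\<close>. Hence the orbit of \<open>x\<close> stays at bounded distance from \<open>x\<close>, and contracting this
  bound \<open>n\<close> times shows that the orbit is Cauchy. Its limit \<open>y\<close> is fixed because
  \<open>\<Phi>(u, v) \<le> \<Phi>(m, m) = m \<Phi>(1, 1)\<close> for \<open>m = max u v\<close>, so that \<open>d(T y, y)\<close> is
  arbitrarily small.
\<close>

text \<open>Homogeneity of \<open>\<Phi>\<close> is available only at nonnegative arguments, so the
  induction must carry nonnegativity of the inner fold along with the scaling identity.\<close>

lemma foldr_homogeneous:
  fixes \<Phi> :: "real \<Rightarrow> real \<Rightarrow> real"
  assumes hom: "\<And>k u v. \<lbrakk>0 \<le> k; 0 \<le> u; 0 \<le> v\<rbrakk> \<Longrightarrow> \<Phi> (k * u) (k * v) = k * \<Phi> u v"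
    and nonneg: "\<And>u v. \<lbrakk>0 \<le> u; 0 \<le> v\<rbrakk> \<Longrightarrow> 0 \<le> \<Phi> u v"
    and "0 \<le> k" "0 \<le> b" "\<forall>x\<in>set xs. 0 \<le> x"
  shows "foldr \<Phi> (map ((*) k) xs) (k * b) = k * foldr \<Phi> xs b \<and> 0 \<le> foldr \<Phi> xs b"
  using assms(3-5) by (induction xs) (auto simp: hom nonneg)

lemma iterated_nonneg:
  assumes hom: "\<And>k u v. \<lbrakk>0 \<le> k; 0 \<le> u; 0 \<le> v\<rbrakk> \<Longrightarrow> \<Phi> (k * u) (k * v) = k * \<Phi> u v"
    and nonneg: "\<And>u v. \<lbrakk>0 \<le> u; 0 \<le> v\<rbrakk> \<Longrightarrow> 0 \<le> \<Phi> u v"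
    and "0 \<le> a"
  shows "0 \<le> iterated \<Phi> a p"
  unfolding iterated_def
  using foldr_homogeneous[of \<Phi>, OF hom nonneg, of a "a ^ p" "map (\<lambda>i. a ^ i) [0..<p]"] \<open>0 \<le> a\<close>
  by auto

text \<open>Behind the leading 1, the entries a, ..., a^p and the innermost a^(p+1) are
  \<open>a\<close> times the data of the previous expression, so homogeneity pulls one factor
  \<open>a\<close> out of the whole tail.\<close>

lemma iterated_Suc:
  assumes hom: "\<And>k u v. \<lbrakk>0 \<le> k; 0 \<le> u; 0 \<le> v\<rbrakk> \<Longrightarrow> \<Phi> (k * u) (k * v) = k * \<Phi> u v"
    and nonneg: "\<And>u v. \<lbrakk>0 \<le> u; 0 \<le> v\<rbrakk> \<Longrightarrow> 0 \<le> \<Phi> u v"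
    and "0 \<le> a"
  shows "iterated \<Phi> a (Suc p) = \<Phi> 1 (a * iterated \<Phi> a p)"
proof -
  have "map (\<lambda>i. a ^ i) [0..<Suc p] = 1 # map ((*) a) (map (\<lambda>i. a ^ i) [0..<p])"
    by (simp only: map_upt_Suc) (simp add: comp_def)
  then show ?thesis
    unfolding iterated_def
    using foldr_homogeneous[of \<Phi>, OF hom nonneg, of a "a ^ p" "map (\<lambda>i. a ^ i) [0..<p]"] \<open>0 \<le> a\<close>
    by (simp del: upt_Suc)
qed

lemma homogeneous_le_max:
  fixes \<Phi> :: "real \<Rightarrow> real \<Rightarrow> real"
  assumes hom: "\<And>k u v. \<lbrakk>0 \<le> k; 0 \<le> u; 0 \<le> v\<rbrakk> \<Longrightarrow> \<Phi> (k * u) (k * v) = k * \<Phi> u v"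
    and mono: "\<And>u u' v v'. \<lbrakk>0 \<le> u; u \<le> u'; 0 \<le> v; v \<le> v'\<rbrakk> \<Longrightarrow> \<Phi> u v \<le> \<Phi> u' v'"
    and "0 \<le> u" "0 \<le> v"
  shows "\<Phi> u v \<le> max u v * \<Phi> 1 1"
  using mono[of u "max u v" v "max u v"] hom[of "max u v" 1 1] assms(3,4) by simp

lemma triangle_function_mono:
  assumes "triangle_function X d \<Phi>" "0 \<le> u" "u \<le> u'" "0 \<le> v" "v \<le> v'"
  shows "\<Phi> u v \<le> \<Phi> u' v'"
proof -
  have "\<Phi> u v \<le> \<Phi> u' v"
    using assms unfolding triangle_function_def mono_on_def by auto
  also have "\<dots> \<le> \<Phi> u' v'"
    using assms unfolding triangle_function_def mono_on_def by auto
  finally show ?thesis .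
qed

theorem theorem2p1:
  fixes X :: "'a set" and d :: "'a \<Rightarrow> 'a \<Rightarrow> real"
    and \<Phi> :: "real \<Rightarrow> real \<Rightarrow> real" and T :: "'a \<Rightarrow> 'a"
  assumes "semimetric_space X d"
    and "semimetric_complete X d"
    and "triangle_function X d \<Phi>"
    and "continuous (at (0, 0) within {0..} \<times> {0..}) (\<lambda>(u, v). \<Phi> u v)"
    and "\<And>k u v. \<lbrakk>0 \<le> k; 0 \<le> u; 0 \<le> v\<rbrakk> \<Longrightarrow> \<Phi> (k * u) (k * v) = k * \<Phi> u v"
    and "\<And>a. \<lbrakk>0 \<le> a; a < 1\<rbrakk> \<Longrightarrow> \<exists>C>0. \<forall>p\<ge>1. iterated \<Phi> a p \<le> C"
    and "contraction_mapping X d T"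
  shows "\<exists>!x. x \<in> X \<and> T x = x"
proof -
  interpret semimetric_space X d by fact
  note hom = assms(5)
  note mono = triangle_function_mono[OF assms(3)]
  have nonneg_\<Phi>: "0 \<le> \<Phi> u v" if "0 \<le> u" "0 \<le> v" for u v
    using assms(3) that unfolding triangle_function_def by blast
  have triangle: "d x y \<le> \<Phi> (d x z) (d z y)" if "x \<in> X" "y \<in> X" "z \<in> X" for x y z
    using assms(3) that unfolding triangle_function_def by blast
  obtain \<alpha> where \<alpha>: "0 \<le> \<alpha>" "\<alpha> < 1"
    and contr: "\<And>x y. \<lbrakk>x \<in> X; y \<in> X\<rbrakk> \<Longrightarrow> d (T x) (T y) \<le> \<alpha> * d x y"
    and T: "\<And>x. x \<in> X \<Longrightarrow> T x \<in> X"
    using assms(7) unfolding contraction_mapping_def by blast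
  have iter_nonneg: "0 \<le> iterated \<Phi> \<alpha> p" for p
    by (intro iterated_nonneg hom nonneg_\<Phi> \<alpha>(1))
  have iter_Suc: "iterated \<Phi> \<alpha> (Suc p) = \<Phi> 1 (\<alpha> * iterated \<Phi> \<alpha> p)" for p
    by (intro iterated_Suc hom nonneg_\<Phi> \<alpha>(1))
  obtain C where C: "C > 0" "\<And>p. p \<ge> 1 \<Longrightarrow> iterated \<Phi> \<alpha> p \<le> C"
    using assms(6)[OF \<alpha>] by blast
  obtain x0 where x0: "x0 \<in> X" using nonempty by blast
  define s where "s n = (T ^^ n) x0" for n
  define D where "D = d x0 (T x0)"
  have s_Suc: "s (Suc n) = T (s n)" and s_0: "s 0 = x0" for n
    by (simp_all add: s_def)
  have s: "s n \<in> X" for n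
    by (induction n) (auto simp: s_0 s_Suc x0 T)
  have D: "D \<ge> 0" unfolding D_def using x0 T nonneg by blast
  have shift: "d (s (m + n)) (s (m + k)) \<le> \<alpha> ^ m * d (s n) (s k)" for m n k
  proof (induction m)
    case (Suc m)
    have "d (s (Suc m + n)) (s (Suc m + k)) \<le> \<alpha> * d (s (m + n)) (s (m + k))"
      by (simp add: s_Suc contr s)
    also have "\<dots> \<le> \<alpha> * (\<alpha> ^ m * d (s n) (s k))"
      using Suc \<alpha>(1) by (rule mult_left_mono)
    finally show ?case by (simp add: mult.assoc)
  qed simp
  have orbit: "d x0 (s (Suc p)) \<le> D * iterated \<Phi> \<alpha> p" for p
  proof (induction p)
    case 0
    show ?case by (simp add: iterated_def s_Suc s_0 D_def)
  next
    case (Suc p)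
    \<comment> \<open>The intermediate point is \<open>s 1\<close>: the rest of the path is the
      image under \<open>T\<close> of the path from \<open>x0\<close> to \<open>s (Suc p)\<close>,
      so the induction hypothesis applies with an extra factor \<open>\<alpha>\<close>.\<close>
    have "d x0 (s (Suc (Suc p))) \<le> \<Phi> D (d (s 1) (s (1 + Suc p)))"
      using triangle[OF x0 s s, of "Suc (Suc p)" 1] by (simp add: D_def s_Suc s_0)
    also have "\<dots> \<le> \<Phi> D (\<alpha> * (D * iterated \<Phi> \<alpha> p))"
    proof (rule mono)
      show "d (s 1) (s (1 + Suc p)) \<le> \<alpha> * (D * iterated \<Phi> \<alpha> p)"
        using shift[of 1 0 "Suc p"] mult_left_mono[OF Suc \<alpha>(1)] by (simp add: s_0)
    qed (use D nonneg s in auto)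
    \<comment> \<open>Writing \<open>D\<close> as \<open>D * 1\<close> exposes the common factor.
      Since nothing is divided by \<open>D\<close>, the case where \<open>x0\<close> is already
      fixed is included.\<close>
    also have "\<dots> = \<Phi> (D * 1) (D * (\<alpha> * iterated \<Phi> \<alpha> p))"
      by (simp add: mult.left_commute)
    also have "\<dots> = D * iterated \<Phi> \<alpha> (Suc p)"
      using D \<alpha>(1) by (simp only: iter_Suc, intro hom) (auto simp: iter_nonneg)
    finally show ?case .
  qed
  \<comment> \<open>\<open>C\<close> bounds the iterated expression only from p = 1 on; at p = 0 its
    value is 1, and \<open>1 + C\<close> covers both cases.\<close>
  define M where "M = D * (1 + C)"
  have M: "M \<ge> 0" using D C(1) by (simp add: M_def)
  have orbit_le: "d x0 (s q) \<le> M" for q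
  proof (cases q)
    case 0
    then show ?thesis using zero_iff[OF x0 x0] M by (simp add: s_0)
  next
    case (Suc p)
    have "iterated \<Phi> \<alpha> p \<le> 1 + C"
      using C(2)[of p] C(1) by (cases p) (auto simp: iterated_def)
    then show ?thesis
      using orbit[of p] mult_left_mono[OF _ D] Suc unfolding M_def by fastforce
  qed
  have dist_le: "d (s n) (s m) \<le> \<alpha> ^ N * M" if "N \<le> n" "N \<le> m" for N n m
  proof -
    \<comment> \<open>Contracting \<open>n\<close> times from the pair \<open>x0\<close>,
      \<open>s (m - n)\<close> leaves a distance bounded by \<open>M\<close> whatever the gap is, so
      no sum over consecutive steps arises. Symmetry of \<open>d\<close> then removes the assumption
      n \<le> m.\<close>
    have le: "d (s n) (s m) \<le> \<alpha> ^ N * M" if "N \<le> n" "n \<le> m" for n m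
    proof -
      have "d (s n) (s m) \<le> \<alpha> ^ n * d x0 (s (m - n))"
        using shift[of n 0 "m - n"] that by (simp add: s_0)
      also have "\<dots> \<le> \<alpha> ^ N * M"
        using \<alpha> that M x0 s
        by (intro mult_mono orbit_le power_decreasing) (auto simp: nonneg)
      finally show ?thesis .
    qed
    show ?thesis
      using le[of n m] le[of m n] that sym[OF s s, of n m] by linarith
  qed
  have lim: "(\<lambda>N. \<alpha> ^ N * M) \<longlonglongrightarrow> 0"
    using \<alpha> by (intro tendsto_mult_left_zero LIMSEQ_power_zero) simp
  have "semimetric_Cauchy X d s"
    unfolding semimetric_Cauchy_def
  proof (intro conjI allI impI)
    fix \<epsilon> :: real assume "0 < \<epsilon>"
    then obtain N where "\<alpha> ^ N * M < \<epsilon>"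
      using order_tendstoD(2)[OF lim] by (force simp: eventually_sequentially)
    then show "\<exists>N. \<forall>n\<ge>N. \<forall>m\<ge>N. d (s n) (s m) < \<epsilon>"
      using dist_le by (meson le_less_trans)
  qed (use s in auto)
  then obtain y where y: "y \<in> X" and conv: "(\<lambda>n. d (s n) y) \<longlonglongrightarrow> 0"
    using assms(2) unfolding semimetric_complete_def semimetric_converges_def by blast
  \<comment> \<open>A semimetric need not be continuous, so the limit is not taken inside
    \<open>d\<close>. Instead the fixed number \<open>d (T y) y\<close> is bounded by a sequence
    built from \<open>d (s n) y\<close>, which tends to 0.\<close>
  have "d (T y) y \<le> max (\<alpha> * d (s n) y) (d (s (Suc n)) y) * \<Phi> 1 1" for n
  proof -
    have "d (T y) y \<le> \<Phi> (d (T y) (s (Suc n))) (d (s (Suc n)) y)"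
      by (intro triangle y s T)
    also have "\<dots> \<le> \<Phi> (\<alpha> * d (s n) y) (d (s (Suc n)) y)"
      using contr[OF y s, of n] sym[OF y s, of n]
      by (intro mono) (auto simp: s_Suc nonneg y s T)
    also have "\<dots> \<le> max (\<alpha> * d (s n) y) (d (s (Suc n)) y) * \<Phi> 1 1"
      using \<alpha>(1) y s by (intro homogeneous_le_max hom mono) (auto simp: nonneg)
    finally show ?thesis .
  qed
  moreover have "(\<lambda>n. max (\<alpha> * d (s n) y) (d (s (Suc n)) y) * \<Phi> 1 1) \<longlonglongrightarrow> max (\<alpha> * 0) 0 * \<Phi> 1 1"
    by (intro tendsto_intros conv LIMSEQ_Suc[OF conv])
  ultimately have "d (T y) y \<le> 0"
    by (intro LIMSEQ_le_const[where X = "\<lambda>n. max (\<alpha> * d (s n) y) (d (s (Suc n)) y) * \<Phi> 1 1"]) auto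
  then have fixed: "T y = y"
    using nonneg[OF T[OF y] y] zero_iff[OF T[OF y] y] by simp
  have "z = y" if z: "z \<in> X" "T z = z" for z
  proof -
    \<comment> \<open>Both points are fixed, so the contraction inequality compares
      \<open>d z y\<close> with \<open>\<alpha>\<close> times itself.\<close>
    have "(1 - \<alpha>) * d z y \<le> 0"
      using contr[OF z(1) y] z(2) fixed by (simp add: algebra_simps)
    then have "d z y \<le> 0"
      using \<alpha>(2) by (simp add: mult_le_0_iff)
    then show ?thesis
      using nonneg[OF z(1) y] zero_iff[OF z(1) y] by simp
  qed
  with y fixed show ?thesis by blast
qed

end
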